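(* Let $\delta=h/\gamma$ be fixed. Let $\omega=\mu_1/\mu_2$ and $$\epsilon(\gamma)=\delta-\frac{2m\omega}{1+3\omega}(1+\sqrt\omega)^2-\frac{(1+\sqrt\omega)^2}{1+\omega}.$$ For $\omega=\mu_1/\mu_2$ close to $0$ with $\epsilon>0$, we have $$-\frac{d}{d\gamma}\log E(\gamma)\ge(\sqrt{\mu_1}+\sqrt{\mu_2})^{-2}\,\epsilon.$$ Then $E(\gamma)$ has the exponential decay for $\gamma>\mu_2$, $$E(\gamma)=E(\mu_2)\exp\!\left(-\epsilon\,(\gamma-\mu_2)(\sqrt{\mu_1}+\sqrt{\mu_2})^{-2}\right).$$
   Context: Here $m$ is a positive integer (the Krylov dimension), $h>0$ the time step, $\gamma>0$ the shift parameter, and $0<\mu_1<\mu_2$ are given real numbers. For $\gamma>0$, $$c_0=\tfrac12\left((1+\gamma/\mu_2)^{-1}+(1+\gamma/\mu_1)^{-1}\right),\qquad \rho=\tfrac12\left((1+\gamma/\mu_2)^{-1}-(1+\gamma/\mu_1)^{-1}\right),$$ and $$E(\gamma)=\exp\!\left(\frac h\gamma\Bigl(1-\frac1{2c_0}\Bigr)\right)\left(\frac{\rho}{c_0}\right)^m\frac1{c_0-\rho},$$ regarded as a function of $\gamma$ with $h=\delta\gamma$. (The quantity written $\epsilon(\gamma)$ is abbreviated $\epsilon$.)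
   Formalization: The final equality for E(γ) is replaced by the upper bound "≤" (equality fails for every γ > μ2, since the derivative bound is strict), and the bound on −d/dγ log E is stated for γ ≥ μ2 (it fails as γ → 0). *)

theory Defs
  imports "HOL-Analysis.Analysis"
begin

definition c0 :: "real \<Rightarrow> real \<Rightarrow> real \<Rightarrow> real" where
  "c0 \<mu>1 \<mu>2 \<gamma> = 1/2 * (inverse (1 + \<gamma> / \<mu>2) + inverse (1 + \<gamma> / \<mu>1))"

definition rho :: "real \<Rightarrow> real \<Rightarrow> real \<Rightarrow> real" where
  "rho \<mu>1 \<mu>2 \<gamma> = 1/2 * (inverse (1 + \<gamma> / \<mu>2) - inverse (1 + \<gamma> / \<mu>1))"

definition E_step :: "real \<Rightarrow> nat \<Rightarrow> real \<Rightarrow> real \<Rightarrow> real \<Rightarrow> real" where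
  "E_step h m \<mu>1 \<mu>2 \<gamma> =
     exp (h / \<gamma> * (1 - 1 / (2 * c0 \<mu>1 \<mu>2 \<gamma>)))
     * (rho \<mu>1 \<mu>2 \<gamma> / c0 \<mu>1 \<mu>2 \<gamma>) ^ m
     * (1 / (c0 \<mu>1 \<mu>2 \<gamma> - rho \<mu>1 \<mu>2 \<gamma>))"

text \<open>
  The error factor as a function of the shift \<open>\<gamma>\<close> alone: the ratio \<open>\<delta> = h / \<gamma>\<close> is held
  fixed, so the time step \<open>h = \<delta> \<gamma>\<close> varies with \<open>\<gamma>\<close>.
\<close>

definition E :: "real \<Rightarrow> nat \<Rightarrow> real \<Rightarrow> real \<Rightarrow> real \<Rightarrow> real" where
  "E \<delta> m \<mu>1 \<mu>2 \<gamma> = E_step (\<delta> * \<gamma>) m \<mu>1 \<mu>2 \<gamma>"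

text \<open>
  The decay rate depends only on \<open>\<delta>\<close>, \<open>m\<close> and the ratio \<open>\<omega> = \<mu>1 / \<mu>2\<close>, not on \<open>\<gamma>\<close>.
\<close>

definition eps :: "real \<Rightarrow> nat \<Rightarrow> real \<Rightarrow> real" where
  "eps \<delta> m \<omega> =
     \<delta> - 2 * real m * \<omega> / (1 + 3 * \<omega>) * (1 + sqrt \<omega>)^2 - (1 + sqrt \<omega>)^2 / (1 + \<omega>)"

end

theory Submission
  imports Defs
begin

text \<open>
  Write \<open>a = \<mu>1\<close>, \<open>b = \<mu>2\<close>. With \<open>\<delta> = h / \<gamma>\<close> held fixed, clearing denominators turns \<open>log E\<close>
  into an elementary function of \<open>\<gamma>\<close> whose negative derivative is
  \<open>\<delta> F'(\<gamma>) - m \<cdot> 2ab / (\<gamma> (2ab + (a+b) \<gamma>)) - 1 / (a + \<gamma>)\<close>, where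
  \<open>F(\<gamma>) = (a + \<gamma>) (b + \<gamma>) / (2ab + (a+b) \<gamma>)\<close>.

  The rate \<open>(\<surd>a + \<surd>b)\<^sup>-\<^sup>2 \<epsilon>\<close> has the same shape: its three terms are
  \<open>\<delta> / (\<surd>a + \<surd>b)\<^sup>2\<close> and the second and third terms above evaluated at \<open>\<gamma> = b\<close>. The comparison
  can therefore be made term by term. The two subtracted terms decrease in \<open>\<gamma>\<close>, so for
  \<open>\<gamma> \<ge> b\<close> they are largest at \<open>\<gamma> = b\<close>. For the remaining one, polynomial division shows
  that \<open>F'\<close> exceeds its limit \<open>1 / (a+b)\<close> at infinity by a positive multiple of
  \<open>(a+b)\<^sup>2 - 4ab = (a-b)\<^sup>2\<close>, and \<open>a + b \<le> (\<surd>a + \<surd>b)\<^sup>2\<close>.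

  The bound on \<open>E\<close> itself follows by integrating this differential inequality from \<open>\<mu>2\<close> to \<open>\<gamma>\<close>.
\<close>

lemma E_closed_form:
  assumes "0 < a" "0 < b" "0 < g"
  shows "E \<delta> m a b g =
           exp (\<delta> * (1 - (a + g) * (b + g) / (2*a*b + (a + b) * g)))
           * ((b - a) * g / (2*a*b + (a + b) * g)) ^ m * ((a + g) / a)"
proof -
  let ?D = "2*a*b + (a + b) * g"
  have D: "?D > 0" using assms by (intro add_pos_pos mult_pos_pos) auto
  have ia: "inverse (1 + g / a) = a / (a + g)" and ib: "inverse (1 + g / b) = b / (b + g)"
    using assms by (auto simp: field_simps)
  have nz: "a + g \<noteq> 0" "b + g \<noteq> 0" using assms by auto
  have c: "c0 a b g = ?D / (2 * ((a + g) * (b + g)))"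
    unfolding c0_def ia ib using nz by (simp add: divide_simps) (simp add: algebra_simps)
  have r: "rho a b g = (b - a) * g / (2 * ((a + g) * (b + g)))"
    unfolding rho_def ia ib using nz by (simp add: divide_simps) (simp add: algebra_simps)
  have "1 / (2 * c0 a b g) = (a + g) * (b + g) / ?D"
    unfolding c using nz D by (simp add: divide_simps)
  moreover have "rho a b g / c0 a b g = (b - a) * g / ?D"
    unfolding c r using nz D by (simp add: divide_simps)
  moreover have "1 / (c0 a b g - rho a b g) = (a + g) / a"
    unfolding c0_def rho_def ia ib using nz assms by (simp add: divide_simps)
  ultimately show ?thesis using assms by (simp add: E_def E_step_def)
qed

lemma E_pos:
  assumes "0 < a" "a < b" "0 < g"
  shows "E \<delta> m a b g > 0"
proof -
  have "2*a*b + (a + b) * g > 0" using assms by (intro add_pos_pos mult_pos_pos) auto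
  then show ?thesis
    using assms by (subst E_closed_form) (auto intro!: mult_pos_pos divide_pos_pos)
qed

lemma ln_E_has_derivative:
  assumes "0 < a" "a < b" "0 < g"
  shows "((\<lambda>g. ln (E \<delta> m a b g)) has_real_derivative
           - (\<delta> * (((a + b) * g^2 + 4*a*b * g + a*b * (a + b)) / (2*a*b + (a + b) * g)^2)
              - real m * (2*a*b / (g * (2*a*b + (a + b) * g))) - 1 / (a + g))) (at g)"
    (is "(_ has_real_derivative ?d) _")
proof -
  let ?D = "\<lambda>g. 2*a*b + (a + b) * g"
  let ?L = "\<lambda>g. \<delta> * (1 - (a + g) * (b + g) / ?D g)
                + real m * (ln ((b - a) * g) - ln (?D g)) + (ln (a + g) - ln a)"
  have Dpos: "?D x > 0" if "x > 0" for x
    using assms that by (intro add_pos_pos mult_pos_pos) auto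
  have L: "ln (E \<delta> m a b x) = ?L x" if "x > 0" for x
    using assms that Dpos[OF that]
    by (simp add: E_closed_form ln_mult ln_div ln_realpow)
  have D: "?D g > 0" using Dpos assms by blast
  have F: "((\<lambda>g. (a + g) * (b + g) / ?D g) has_real_derivative
             ((a + b) * g^2 + 4*a*b * g + a*b * (a + b)) / (?D g)^2) (at g)"
    using D by (auto intro!: derivative_eq_intros simp: power2_eq_square divide_simps)
               (simp add: algebra_simps)
  have P: "((\<lambda>g. ln ((b - a) * g) - ln (?D g)) has_real_derivative 2*a*b / (g * ?D g)) (at g)"
    using D assms by (auto intro!: derivative_eq_intros simp: divide_simps)
  have Q: "((\<lambda>g. ln (a + g) - ln a) has_real_derivative 1 / (a + g)) (at g)"
    using assms by (auto intro!: derivative_eq_intros)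
  have "(?L has_real_derivative ?d) (at g)"
    using DERIV_add[OF DERIV_add[OF DERIV_cmult[OF DERIV_diff[OF DERIV_const F], of \<delta> 1]
                                   DERIV_cmult[OF P, of "real m"]] Q]
    by (simp add: algebra_simps)
  then show ?thesis
    by (rule has_field_derivative_transform_within_open[where S = "{0<..}"])
       (use assms L in auto)
qed

text \<open>
  Each of the two correction terms of \<open>eps\<close> carries a factor \<open>(1 + \<surd>\<omega>)\<^sup>2\<close>, which is
  \<open>(\<surd>a + \<surd>b)\<^sup>2 / b\<close> and so cancels against the prefactor of the decay rate.
\<close>

lemma decay_rate_expand:
  assumes "0 < a" "0 < b"
  shows "(sqrt a + sqrt b) powi (-2) * eps \<delta> m (a / b) =
           \<delta> / (sqrt a + sqrt b)^2 - real m * (2*a*b / (b * (2*a*b + (a + b) * b))) - 1 / (a + b)"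
proof -
  let ?S = "(sqrt a + sqrt b)^2"
  have S: "?S > 0" using assms by (intro zero_less_power add_pos_pos) auto
  have "1 + sqrt (a / b) = (sqrt a + sqrt b) / sqrt b"
    using assms by (simp add: real_sqrt_divide field_simps)
  then have q: "(1 + sqrt (a / b))^2 = ?S / b"
    using assms by (simp add: power_divide)
  have "inverse ?S * (2 * real m * (a / b) / (1 + 3 * (a / b)) * (?S / b))
        = real m * (2*a*b / (b * (2*a*b + (a + b) * b)))"
  proof -
    have "2 * real m * (a / b) / (1 + 3 * (a / b)) = 2 * real m * a / (b + 3 * a)"
      using assms by (simp add: field_simps)
    moreover have "2*a*b / (b * (2*a*b + (a + b) * b)) = 2 * a / (b * (b + 3 * a))"
    proof -
      have "b * (2*a*b + (a + b) * b) = (b * (b + 3 * a)) * b" by algebra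
      then show ?thesis using assms by simp
    qed
    ultimately show ?thesis using S by (simp add: field_simps)
  qed
  moreover have "inverse ?S * (?S / b / (1 + a / b)) = 1 / (a + b)"
  proof -
    have "b * (1 + a / b) = a + b" using assms by (simp add: field_simps)
    then show ?thesis using S by (simp add: field_simps)
  qed
  ultimately show ?thesis
    unfolding eps_def q by (simp add: power_int_minus right_diff_distrib divide_inverse_commute)
qed

text \<open>
  The left-hand side below is the derivative of \<open>F\<close>. Cross-multiplying with \<open>1 / (a+b)\<close> leaves
  \<open>ab ((a+b)\<^sup>2 - 4ab) \<ge> 0\<close>, the arithmetic-geometric mean inequality.
\<close>

lemma exponent_slope_lower_bound:
  assumes "0 < a" "0 < b" "0 < g"
  shows "((a + b) * g^2 + 4*a*b * g + a*b * (a + b)) / (2*a*b + (a + b) * g)^2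
           \<ge> 1 / (sqrt a + sqrt b)^2"
proof -
  let ?D = "2*a*b + (a + b) * g"
  have D: "?D > 0" using assms by (intro add_pos_pos mult_pos_pos) auto
  have "(sqrt a + sqrt b)^2 = a + b + 2 * (sqrt a * sqrt b)"
    using assms by (simp add: power2_sum)
  also have "\<dots> \<ge> a + b" using assms by simp
  finally have "1 / (sqrt a + sqrt b)^2 \<le> 1 / (a + b)"
    using assms by (intro divide_left_mono mult_pos_pos zero_less_power add_pos_pos) auto
  also have "\<dots> \<le> ((a + b) * g^2 + 4*a*b * g + a*b * (a + b)) / ?D^2"
  proof -
    have "((a + b) * g^2 + 4*a*b * g + a*b * (a + b)) * (a + b) - ?D^2 = a * b * (a - b)^2"
      by algebra
    moreover have "a * b * (a - b)^2 \<ge> 0" using assms by simp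
    ultimately have "?D^2 \<le> ((a + b) * g^2 + 4*a*b * g + a*b * (a + b)) * (a + b)"
      by linarith
    then show ?thesis using D assms by (simp add: pos_le_divide_eq pos_divide_le_eq)
  qed
  finally show ?thesis .
qed

lemma ln_E_decay_rate:
  assumes "0 \<le> \<delta>" "0 < a" "a < b" "b \<le> g"
  shows "- deriv (\<lambda>g. ln (E \<delta> m a b g)) g \<ge> (sqrt a + sqrt b) powi (-2) * eps \<delta> m (a / b)"
proof -
  have b: "0 < b" and g: "0 < g" using assms by auto
  let ?D = "\<lambda>g. 2*a*b + (a + b) * g"
  have "\<delta> / (sqrt a + sqrt b)^2
        \<le> \<delta> * (((a + b) * g^2 + 4*a*b * g + a*b * (a + b)) / (?D g)^2)"
    using mult_left_mono[OF exponent_slope_lower_bound[OF assms(2) b g] assms(1)] by simp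
  moreover have "real m * (2*a*b / (g * ?D g)) \<le> real m * (2*a*b / (b * ?D b))"
    using assms b g
    by (intro mult_left_mono divide_left_mono mult_mono mult_pos_pos add_pos_pos) auto
  moreover have "1 / (a + g) \<le> 1 / (a + b)"
    using assms b by (intro divide_left_mono) auto
  moreover note DERIV_imp_deriv[OF ln_E_has_derivative[OF assms(2,3) g, of \<delta> m]]
  ultimately show ?thesis
    unfolding decay_rate_expand[OF assms(2) b] by linarith
qed

text \<open>
  Integrated form of a differential inequality: a lower bound \<open>r\<close> on the logarithmic decay rate
  makes \<open>ln f(x) + r x\<close> nonincreasing.
\<close>

lemma exponential_decay_from_log_derivative:
  fixes f :: "real \<Rightarrow> real"
  assumes "x0 \<le> x" and pos: "\<And>t. x0 \<le> t \<Longrightarrow> f t > 0"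
    and diff: "\<And>t. x0 \<le> t \<Longrightarrow> (\<lambda>t. ln (f t)) differentiable at t"
    and rate: "\<And>t. x0 \<le> t \<Longrightarrow> r \<le> - deriv (\<lambda>t. ln (f t)) t"
  shows "f x \<le> f x0 * exp (- r * (x - x0))"
proof -
  have "ln (f x) + r * x \<le> ln (f x0) + r * x0"
  proof (rule DERIV_nonpos_imp_nonincreasing[OF assms(1)])
    fix t assume t: "x0 \<le> t" "t \<le> x"
    have "((\<lambda>t. ln (f t)) has_real_derivative deriv (\<lambda>t. ln (f t)) t) (at t)"
      using diff[OF t(1)] DERIV_imp_deriv real_differentiable_def by fastforce
    from DERIV_add[OF this DERIV_cmult_Id[of r]]
    have "((\<lambda>t. ln (f t) + r * t) has_real_derivative deriv (\<lambda>t. ln (f t)) t + r) (at t)" .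
    then show "\<exists>y. ((\<lambda>t. ln (f t) + r * t) has_real_derivative y) (at t) \<and> y \<le> 0"
      using rate[OF t(1)] by (intro exI conjI) (assumption, linarith)
  qed
  then have "ln (f x) \<le> ln (f x0) + - r * (x - x0)" by (simp add: algebra_simps)
  then have "exp (ln (f x)) \<le> exp (ln (f x0) + - r * (x - x0))" by simp
  then show ?thesis using pos[of x] pos[of x0] assms(1) by (simp only: exp_add exp_ln order_refl)
qed

theorem proposition2p12:
  "\<forall>\<^sub>F \<omega> in at_right (0::real).
     \<forall>(m::nat) (\<delta>::real) (\<mu>1::real) (\<mu>2::real).
       m > 0 \<longrightarrow> \<delta> > 0 \<longrightarrow> 0 < \<mu>1 \<longrightarrow> \<mu>1 < \<mu>2 \<longrightarrow> \<omega> = \<mu>1 / \<mu>2 \<longrightarrow> eps \<delta> m \<omega> > 0 \<longrightarrow>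
       (\<forall>\<gamma>\<ge>\<mu>2.
          (\<lambda>g. ln (E \<delta> m \<mu>1 \<mu>2 g)) differentiable at \<gamma> \<and>
          - deriv (\<lambda>g. ln (E \<delta> m \<mu>1 \<mu>2 g)) \<gamma> \<ge> (sqrt \<mu>1 + sqrt \<mu>2) powi (-2) * eps \<delta> m \<omega>) \<and>
       (\<forall>\<gamma>>\<mu>2.
          E \<delta> m \<mu>1 \<mu>2 \<gamma>
            \<le> E \<delta> m \<mu>1 \<mu>2 \<mu>2
              * exp (- eps \<delta> m \<omega> * (\<gamma> - \<mu>2) * (sqrt \<mu>1 + sqrt \<mu>2) powi (-2)))"
proof (intro always_eventually allI impI)
  fix \<omega> \<delta> \<mu>1 \<mu>2 :: real and m :: nat
  assume "\<delta> > 0" and \<mu>: "0 < \<mu>1" "\<mu>1 < \<mu>2" and \<omega>: "\<omega> = \<mu>1 / \<mu>2"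
  let ?r = "(sqrt \<mu>1 + sqrt \<mu>2) powi (-2) * eps \<delta> m \<omega>"
  have diff: "(\<lambda>g. ln (E \<delta> m \<mu>1 \<mu>2 g)) differentiable at \<gamma>" if "\<mu>2 \<le> \<gamma>" for \<gamma>
    using ln_E_has_derivative[OF \<mu>, of \<gamma>] \<mu> that real_differentiable_def by fastforce
  have rate: "?r \<le> - deriv (\<lambda>g. ln (E \<delta> m \<mu>1 \<mu>2 g)) \<gamma>" if "\<mu>2 \<le> \<gamma>" for \<gamma>
    unfolding \<omega> using ln_E_decay_rate \<open>\<delta> > 0\<close> \<mu> that by simp
  have "E \<delta> m \<mu>1 \<mu>2 \<gamma> \<le> E \<delta> m \<mu>1 \<mu>2 \<mu>2 * exp (- ?r * (\<gamma> - \<mu>2))" if "\<mu>2 < \<gamma>" for \<gamma>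
    using that \<mu>
    by (intro exponential_decay_from_log_derivative[OF _ E_pos diff rate]) auto
  then show "(\<forall>\<gamma>\<ge>\<mu>2. (\<lambda>g. ln (E \<delta> m \<mu>1 \<mu>2 g)) differentiable at \<gamma> \<and>
                     ?r \<le> - deriv (\<lambda>g. ln (E \<delta> m \<mu>1 \<mu>2 g)) \<gamma>) \<and>
             (\<forall>\<gamma>>\<mu>2. E \<delta> m \<mu>1 \<mu>2 \<gamma> \<le> E \<delta> m \<mu>1 \<mu>2 \<mu>2
                * exp (- eps \<delta> m \<omega> * (\<gamma> - \<mu>2) * (sqrt \<mu>1 + sqrt \<mu>2) powi (-2)))"
    using diff rate by (simp add: mult_ac)
qed

end
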